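(* Let $\ge$ be a local monomial order on the monomials of $R=\mathbb{C}[x_1,\dots,x_N]$ and let $\succeq$ be the corresponding dual order. For every ideal $I\subset R$, the monomial lattice $\mathbb{N}^N$ is the disjoint union of $\operatorname{in}_\succeq D_0[I]$ and $\operatorname{in}_\ge I$ (both regarded as sets of exponent vectors).
   Context: Let $R=\mathbb{C}[x_1,\dots,x_N]$ and $\mathbb{N}=\mathbb{Z}_{\ge0}$. For $\alpha\in\mathbb{N}^N$ let $\partial^\alpha:R\to\mathbb{C}$ be the functional $\partial^\alpha(g)=\left(\frac{1}{\alpha!}\frac{\partial^{|\alpha|}g}{\partial x^\alpha}\right)(0)$, with $\alpha!=\alpha_1!\cdots\alpha_N!$, $|\alpha|=\sum_i\alpha_i$. Let $D_0=\operatorname{span}_{\mathbb{C}}\{\partial^\alpha : \alpha\in\mathbb{N}^N\}$ (finite linear combinations), and $D_0[I]=\{q\in D_0 : q(f)=0\text{ for all } f\in I\}$. A local monomial order $\ge$ is a total order on monomials compatible with multiplication in which $1$ is the largest monomial. For a nonzero polynomial $g=\sum_\alpha a_\alpha x^\alpha$, $\operatorname{in}_\ge(g)=\max_\ge\{x^\alpha : a_\alpha\ne0\}$, and $\operatorname{in}_\ge(I)=\{\operatorname{in}_\ge(f) : 0\neq f\in I\}$. The dual order on the monomial functionals is the opposite order: $\partial^\alpha\succeq\partial^\beta\iff x^\alpha\le x^\beta$. For nonzero $q=\sum_\alpha c_\alpha\partial^\alpha\in D_0$, $\operatorname{in}_\succeq(q)=\max_\succeq\{\partial^\alpha : c_\alpha\neq0\}$,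 and $\operatorname{in}_\succeq D_0[I]=\{\operatorname{in}_\succeq(q) : 0\ne q\in D_0[I]\}$. Monomials $x^\alpha$ and functionals $\partial^\alpha$ are both identified with the exponent vector $\alpha\in\mathbb{N}^N$. *)

theory Defs
  imports Complex_Main "HOL-Library.Poly_Mapping"
begin

text \<open>
  The polynomial ring in finitely many variables over the complex numbers. The variables are the
  elements of a finite type \<open>'n\<close>, exponent vectors are (automatically finitely supported) maps
  from \<open>'n\<close> to \<open>nat\<close>, and a polynomial is a finitely supported map from exponent
  vectors to coefficients, with the convolution product of \<open>Poly_Mapping\<close>.
\<close>

type_synonym 'n expo = "'n \<Rightarrow>\<^sub>0 nat"

type_synonym 'n cpoly = "'n expo \<Rightarrow>\<^sub>0 complex"

text \<open>An ideal is a submodule of the ring regarded as a module over itself.\<close>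

definition poly_ideal :: "'n::finite cpoly set \<Rightarrow> bool"
  where "poly_ideal I \<longleftrightarrow> module.subspace (*) I"

lemma poly_ideal_iff:
  "poly_ideal I \<longleftrightarrow> 0 \<in> I \<and> (\<forall>f\<in>I. \<forall>g\<in>I. f + g \<in> I) \<and> (\<forall>h. \<forall>f\<in>I. h * f \<in> I)"
proof -
  have "module ((*) :: 'n::finite cpoly \<Rightarrow> _)"
    by (rule module.intro) (rule distrib_left distrib_right mult.assoc[symmetric] mult_1_left)+
  from module.subspace_def[OF this] show ?thesis
    unfolding poly_ideal_def .
qed


section \<open>The functionals dual to the monomials\<close>

definition pdiff :: "'n::finite \<Rightarrow> 'n cpoly \<Rightarrow> 'n cpoly"
  where "pdiff i g =
    (\<Sum>\<beta>\<in>Poly_Mapping.keys g.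
      Poly_Mapping.single (\<beta> - Poly_Mapping.single i 1)
        (of_nat (Poly_Mapping.lookup \<beta> i) * Poly_Mapping.lookup g \<beta>))"

text \<open>
  The iterated partial derivative. The fold over the set of variables has a value independent of
  the order because partial derivatives commute (\<open>pdiff_commute\<close>).
\<close>

definition pdiff_multi :: "'n::finite expo \<Rightarrow> 'n cpoly \<Rightarrow> 'n cpoly"
  where "pdiff_multi \<alpha> g =
    Finite_Set.fold (\<lambda>i. pdiff i ^^ Poly_Mapping.lookup \<alpha> i) g UNIV"

definition eval_cpoly :: "('n::finite \<Rightarrow> complex) \<Rightarrow> 'n cpoly \<Rightarrow> complex"
  where "eval_cpoly x g =
    (\<Sum>\<beta>\<in>Poly_Mapping.keys g. Poly_Mapping.lookup g \<beta> * (\<Prod>i\<in>UNIV. x i ^ Poly_Mapping.lookup \<beta> i))"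

definition expo_fact :: "'n::finite expo \<Rightarrow> complex"
  where "expo_fact \<alpha> = (\<Prod>i\<in>UNIV. fact (Poly_Mapping.lookup \<alpha> i))"

definition mono_functional :: "'n::finite expo \<Rightarrow> 'n cpoly \<Rightarrow> complex"
  where "mono_functional \<alpha> g = 1 / expo_fact \<alpha> * eval_cpoly (\<lambda>_. 0) (pdiff_multi \<alpha> g)"

text \<open>The finite linear combination of the monomial functionals with coefficients \<open>c\<close>.\<close>

definition functional_of :: "('n::finite expo \<Rightarrow>\<^sub>0 complex) \<Rightarrow> 'n cpoly \<Rightarrow> complex"
  where "functional_of c =
    (\<lambda>g. \<Sum>\<alpha>\<in>Poly_Mapping.keys c. Poly_Mapping.lookup c \<alpha> * mono_functional \<alpha> g)"

definition D0 :: "('n::finite cpoly \<Rightarrow> complex) set"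
  where "D0 = range functional_of"

definition D0_ideal :: "'n::finite cpoly set \<Rightarrow> ('n cpoly \<Rightarrow> complex) set"
  where "D0_ideal I = {q \<in> D0. \<forall>f\<in>I. q f = 0}"

text \<open>
  The coefficients of an element of \<open>D0\<close>. They are unique because the monomial functionals are
  linearly independent (\<open>inj_functional_of\<close>).
\<close>

definition functional_coeffs :: "('n::finite cpoly \<Rightarrow> complex) \<Rightarrow> ('n expo \<Rightarrow>\<^sub>0 complex)"
  where "functional_coeffs q = (THE c. q = functional_of c)"


section \<open>Orders and initial terms\<close>

text \<open>\<open>ge \<alpha> \<beta>\<close> stands for the comparison of the monomials with exponents \<open>\<alpha>\<close> and \<open>\<beta>\<close>.\<close>

definition local_monomial_order :: "('n::finite expo \<Rightarrow> 'n expo \<Rightarrow> bool) \<Rightarrow> bool"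
  where "local_monomial_order ge \<longleftrightarrow>
    linear_order {(\<alpha>, \<beta>). ge \<alpha> \<beta>} \<and>
    (\<forall>\<alpha> \<beta> \<gamma>. ge \<alpha> \<beta> \<longrightarrow> ge (\<alpha> + \<gamma>) (\<beta> + \<gamma>)) \<and>
    (\<forall>\<alpha>. ge 0 \<alpha>)"

definition dual_order :: "('n::finite expo \<Rightarrow> 'n expo \<Rightarrow> bool) \<Rightarrow> 'n expo \<Rightarrow> 'n expo \<Rightarrow> bool"
  where "dual_order ge \<alpha> \<beta> \<longleftrightarrow> ge \<beta> \<alpha>"

text \<open>Meaningful for nonempty finite sets and total orders \<open>ge\<close>.\<close>

definition max_wrt :: "('a \<Rightarrow> 'a \<Rightarrow> bool) \<Rightarrow> 'a set \<Rightarrow> 'a"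
  where "max_wrt ge A = (THE m. m \<in> A \<and> (\<forall>a\<in>A. ge m a))"

definition in_poly :: "('n::finite expo \<Rightarrow> 'n expo \<Rightarrow> bool) \<Rightarrow> 'n cpoly \<Rightarrow> 'n expo"
  where "in_poly ge g = max_wrt ge (Poly_Mapping.keys g)"

definition in_ideal :: "('n::finite expo \<Rightarrow> 'n expo \<Rightarrow> bool) \<Rightarrow> 'n cpoly set \<Rightarrow> 'n expo set"
  where "in_ideal ge I = {in_poly ge f |f. f \<in> I \<and> f \<noteq> 0}"

text \<open>In the following two definitions the order is the one on the monomial functionals.\<close>

definition in_functional ::
  "('n::finite expo \<Rightarrow> 'n expo \<Rightarrow> bool) \<Rightarrow> ('n cpoly \<Rightarrow> complex) \<Rightarrow> 'n expo"
  where "in_functional succeq q = max_wrt succeq (Poly_Mapping.keys (functional_coeffs q))"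

definition in_functionals ::
  "('n::finite expo \<Rightarrow> 'n expo \<Rightarrow> bool) \<Rightarrow> ('n cpoly \<Rightarrow> complex) set \<Rightarrow> 'n expo set"
  where "in_functionals succeq Q = {in_functional succeq q |q. q \<in> Q \<and> q \<noteq> (\<lambda>_. 0)}"


section \<open>Well-definedness\<close>

lemma lookup_pdiff:
  "Poly_Mapping.lookup (pdiff i g) \<beta> =
    of_nat (Poly_Mapping.lookup \<beta> i + 1) * Poly_Mapping.lookup g (\<beta> + Poly_Mapping.single i 1)"
proof -
  let ?s = "Poly_Mapping.single i (1::nat)"
  let ?h = "\<lambda>\<gamma>. of_nat (Poly_Mapping.lookup \<gamma> i) * Poly_Mapping.lookup g \<gamma>"
  have *: "(if \<gamma> - ?s = \<beta> then ?h \<gamma> else 0) = (if \<gamma> = \<beta> + ?s then ?h \<gamma> else 0)" for \<gamma>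
  proof (cases "Poly_Mapping.lookup \<gamma> i = 0")
    case True
    then have "\<gamma> \<noteq> \<beta> + ?s" by (auto simp: lookup_add)
    with True show ?thesis by simp
  next
    case False
    then have "\<gamma> - ?s + ?s = \<gamma>"
      by (intro poly_mapping_eqI) (auto simp: lookup_add lookup_minus lookup_single when_def)
    then have "\<gamma> - ?s = \<beta> \<longleftrightarrow> \<gamma> = \<beta> + ?s" by (metis add_diff_cancel_right')
    then show ?thesis by simp
  qed
  have "Poly_Mapping.lookup (pdiff i g) \<beta> =
      (\<Sum>\<gamma>\<in>Poly_Mapping.keys g. if \<gamma> - ?s = \<beta> then ?h \<gamma> else 0)"
    by (simp add: pdiff_def lookup_sum lookup_single when_def)
  also have "\<dots> = (\<Sum>\<gamma>\<in>Poly_Mapping.keys g. if \<gamma> = \<beta> + ?s then ?h \<gamma> else 0)"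
    by (simp only: *)
  also have "\<dots> = ?h (\<beta> + ?s)"
    by (subst sum.delta) (simp_all only: finite_keys in_keys_iff mult_zero_right split: if_split, simp)
  finally show ?thesis by (simp add: lookup_add)
qed

lemma pdiff_commute: "pdiff i (pdiff j g) = pdiff j (pdiff i g)"
  by (cases "i = j")
    (auto intro!: poly_mapping_eqI simp: lookup_pdiff lookup_add lookup_single when_def ac_simps)

lemma pdiff_funpow_commute: "(pdiff i ^^ k) ((pdiff j ^^ l) g) = (pdiff j ^^ l) ((pdiff i ^^ k) g)"
proof -
  have 1: "pdiff i ((pdiff j ^^ l) g) = (pdiff j ^^ l) (pdiff i g)" for g
    by (induction l) (auto simp: pdiff_commute[of i j])
  show ?thesis by (induction k) (auto simp: 1)
qed

lemma lookup_pdiff_funpow: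
  "Poly_Mapping.lookup ((pdiff i ^^ k) g) \<beta> =
    pochhammer (of_nat (Poly_Mapping.lookup \<beta> i) + 1) k *
    Poly_Mapping.lookup g (\<beta> + Poly_Mapping.single i k)"
proof (induction k arbitrary: \<beta>)
  case (Suc k)
  have "\<beta> + Poly_Mapping.single i 1 + Poly_Mapping.single i k = \<beta> + Poly_Mapping.single i (Suc k)"
    by (simp add: add.assoc flip: single_add)
  then show ?case
    by (simp add: lookup_pdiff Suc lookup_add pochhammer_rec ac_simps)
qed simp

lemma lookup_pdiff_fold:
  fixes A :: "'n::finite set"
  shows "Poly_Mapping.lookup (Finite_Set.fold (\<lambda>i. pdiff i ^^ Poly_Mapping.lookup \<alpha> i) g A) \<beta> =
    (\<Prod>i\<in>A. pochhammer (of_nat (Poly_Mapping.lookup \<beta> i) + 1) (Poly_Mapping.lookup \<alpha> i)) *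
    Poly_Mapping.lookup g (\<beta> + (\<Sum>i\<in>A. Poly_Mapping.single i (Poly_Mapping.lookup \<alpha> i)))"
proof -
  interpret comp_fun_commute "\<lambda>i::'n. pdiff i ^^ Poly_Mapping.lookup \<alpha> i"
    by unfold_locales (auto simp: pdiff_funpow_commute)
  have "finite A" by simp
  then show ?thesis
  proof (induction A arbitrary: \<beta> rule: finite_induct)
    case (insert j A)
    have "(\<Prod>i\<in>A. pochhammer (of_nat (Poly_Mapping.lookup
             (\<beta> + Poly_Mapping.single j (Poly_Mapping.lookup \<alpha> j)) i) + 1 :: complex)
             (Poly_Mapping.lookup \<alpha> i)) =
          (\<Prod>i\<in>A. pochhammer (of_nat (Poly_Mapping.lookup \<beta> i) + 1) (Poly_Mapping.lookup \<alpha> i))"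
      using insert.hyps by (intro prod.cong) (auto simp: lookup_add lookup_single when_def)
    with insert show ?case
      by (simp add: fold_insert lookup_pdiff_funpow add.assoc)
  qed simp
qed

lemma eval_cpoly_0: "eval_cpoly (\<lambda>_. 0) g = Poly_Mapping.lookup g (0 :: 'n::finite expo)"
proof -
  have *: "(\<Prod>i\<in>UNIV. (0::complex) ^ Poly_Mapping.lookup \<beta> i) = (if \<beta> = 0 then 1 else 0)"
    for \<beta> :: "'n expo"
    by (auto simp: poly_mapping_eq_iff fun_eq_iff)
  show ?thesis
    by (simp add: eval_cpoly_def * in_keys_iff if_distrib[of "\<lambda>x. _ * x"] cong: if_cong)
qed

lemma mono_functional_eq_lookup: "mono_functional \<alpha> g = Poly_Mapping.lookup g \<alpha>"
proof -
  have "(\<Sum>i\<in>UNIV. Poly_Mapping.single i (Poly_Mapping.lookup \<alpha> i)) = \<alpha>"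
    by (intro poly_mapping_eqI) (simp add: lookup_sum lookup_single when_def)
  then show ?thesis
    by (simp add: mono_functional_def eval_cpoly_0 pdiff_multi_def lookup_pdiff_fold
        expo_fact_def flip: pochhammer_fact)
qed

lemma functional_of_single:
  "functional_of c (Poly_Mapping.single \<alpha> 1) = Poly_Mapping.lookup c \<alpha>"
  by (simp add: functional_of_def mono_functional_eq_lookup lookup_single when_def in_keys_iff
      if_distrib[of "\<lambda>x. _ * x"] cong: if_cong)

lemma inj_functional_of: "inj functional_of"
  by (rule injI) (metis functional_of_single poly_mapping_eqI)

lemma functional_coeffs_functional_of [simp]: "functional_coeffs (functional_of c) = c"
  unfolding functional_coeffs_def using inj_functional_of by (auto dest: injD)

end

theory Submission
  imports Defs
begin

text \<open>
  If \<open>f \<in> I\<close> and \<open>q \<in> D0_ideal I\<close> had the same initial exponent \<open>\<alpha>\<close>, then \<open>\<alpha>\<close> would be the only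
  exponent occurring in both, so \<open>q f\<close> would be a product of two nonzero coefficients.

  Conversely let \<open>\<alpha> \<notin> in_ideal ge I\<close>, and let \<open>J\<close> be \<open>I\<close> plus the span of the monomials below
  \<open>x\<^sup>\<alpha>\<close>. This is an ideal which contains all \<open>x\<^sub>i x\<^sup>\<alpha>\<close> but not \<open>x\<^sup>\<alpha>\<close>. Enlarge \<open>J\<close> to an ideal \<open>K\<close>
  maximal among those avoiding \<open>x\<^sup>\<alpha>\<close>. If \<open>(K : x\<^sub>i\<^sup>k) = (K : x\<^sub>i\<^sup>2\<^sup>k)\<close> with \<open>k > 0\<close>, then
  \<open>(K : x\<^sub>i\<^sup>k) \<inter> (K + (x\<^sub>i\<^sup>k)) = K\<close>; the first ideal contains \<open>x\<^sup>\<alpha>\<close>, so the second does not and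
  maximality gives \<open>x\<^sub>i\<^sup>k \<in> K\<close>. Hence almost all monomials lie in \<open>K\<close>, and a linear functional that
  kills \<open>K\<close> but not \<open>x\<^sup>\<alpha>\<close> is a finite combination of monomial functionals with initial exponent
  \<open>\<alpha>\<close>. For orders that do not refine the degree this replaces Krull's intersection theorem.
\<close>

section \<open>Dickson's lemma\<close>

text \<open>By well-ordering every tail of \<open>s\<close> attains a minimum; picking such
  minimizing indices further and further out gives values that never decrease.\<close>

lemma incseq_subsequence:
  fixes s :: "nat \<Rightarrow> 'a::wellorder"
  shows "\<exists>r. strict_mono r \<and> incseq (s \<circ> r)"
proof -
  have min: "\<exists>n\<ge>m. \<forall>k\<ge>n. s n \<le> s k" for m
  proof -
    define v where "v = (LEAST v. v \<in> s ` {m..})"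
    have "v \<in> s ` {m..}"
      unfolding v_def by (rule LeastI[of _ "s m"]) auto
    then obtain n where "n \<ge> m" "s n = v" by auto
    moreover have "v \<le> s k" if "k \<ge> m" for k
      unfolding v_def using that by (intro Least_le) auto
    ultimately show ?thesis by (meson order_trans)
  qed
  have "\<exists>r. \<forall>n. (\<forall>k\<ge>r n. s (r n) \<le> s k) \<and> r n < r (Suc n)"
  proof (rule dependent_nat_choice)
    fix x n
    show "\<exists>y. (\<forall>k\<ge>y. s y \<le> s k) \<and> x < y"
      using min[of "Suc x"] by (auto simp: Suc_le_eq)
  qed (use min in blast)
  then obtain r where r: "\<And>n k. k \<ge> r n \<Longrightarrow> s (r n) \<le> s k" "\<And>n. r n < r (Suc n)"
    by blast
  show ?thesis
    using r by (intro exI[of _ r] conjI)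
      (auto simp: strict_mono_Suc_iff incseq_Suc_iff less_imp_le)
qed

lemma incseq_subsequence_family:
  fixes s :: "'i \<Rightarrow> nat \<Rightarrow> 'a::wellorder"
  assumes "finite A"
  shows "\<exists>r. strict_mono r \<and> (\<forall>i\<in>A. incseq (s i \<circ> r))"
  using assms
proof (induction A rule: finite_induct)
  case empty
  show ?case by (intro exI[of _ id]) (auto simp: strict_mono_def)
next
  case (insert j A)
  then obtain r where r: "strict_mono r" "\<And>i. i \<in> A \<Longrightarrow> incseq (s i \<circ> r)" by blast
  obtain t where t: "strict_mono t" "incseq (s j \<circ> r \<circ> t)"
    using incseq_subsequence[of "s j \<circ> r"] by auto
  have "incseq (s i \<circ> (r \<circ> t))" if "i \<in> A" for i
    using r(2)[OF that] strict_mono_mono[OF t(1)] by (auto simp: mono_def)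
  with t r(1) show ?case
    by (intro exI[of _ "r \<circ> t"]) (simp add: strict_mono_o comp_assoc del: comp_apply)
qed

text \<open>Along a subsequence on which all coordinates are nondecreasing, the first two exponent
  vectors are comparable coordinatewise, so their truncated difference serves as
  \<open>\<gamma>\<close>.\<close>

lemma dickson:
  fixes a :: "nat \<Rightarrow> 'n::finite expo"
  shows "\<exists>i j \<gamma>. i < j \<and> a j = a i + \<gamma>"
proof -
  obtain r where r: "strict_mono r" "\<And>k. incseq ((\<lambda>n. Poly_Mapping.lookup (a n) k) \<circ> r)"
    using incseq_subsequence_family[of UNIV "\<lambda>k n. Poly_Mapping.lookup (a n) k"] by auto
  have "Poly_Mapping.lookup (a (r 0)) k \<le> Poly_Mapping.lookup (a (r 1)) k" for k
    using r(2)[of k] by (auto simp: mono_def)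
  then have "a (r 1) = a (r 0) + (a (r 1) - a (r 0))"
    by (intro poly_mapping_eqI) (simp add: lookup_add lookup_minus)
  with r(1) show ?thesis by (metis strict_mono_less zero_less_one)
qed

section \<open>Ideals\<close>

abbreviation monomial :: "'n expo \<Rightarrow> 'n::finite cpoly"
  where "monomial \<alpha> \<equiv> Poly_Mapping.single \<alpha> 1"

lemma poly_ideal_0: "poly_ideal I \<Longrightarrow> 0 \<in> I"
  and poly_ideal_add: "poly_ideal I \<Longrightarrow> f \<in> I \<Longrightarrow> g \<in> I \<Longrightarrow> f + g \<in> I"
  and poly_ideal_mult: "poly_ideal I \<Longrightarrow> f \<in> I \<Longrightarrow> h * f \<in> I"
  by (auto simp: poly_ideal_iff)

lemma poly_ideal_diff: "poly_ideal I \<Longrightarrow> f \<in> I \<Longrightarrow> g \<in> I \<Longrightarrow> f - g \<in> I"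
  using poly_ideal_add[of I f "- 1 * g"] poly_ideal_mult[of I g "- 1"] by simp

lemma poly_ideal_sum:
  assumes "poly_ideal I" "poly_ideal J"
  shows "poly_ideal {f + g |f g. f \<in> I \<and> g \<in> J}"
  unfolding poly_ideal_iff
proof (intro conjI ballI allI)
  show "0 \<in> {f + g |f g. f \<in> I \<and> g \<in> J}"
    using assms[THEN poly_ideal_0] by (auto intro!: exI[of _ 0])
next
  fix p q assume "p \<in> {f + g |f g. f \<in> I \<and> g \<in> J}" "q \<in> {f + g |f g. f \<in> I \<and> g \<in> J}"
  then obtain f g f' g' where "p = f + g" "q = f' + g'" "f \<in> I" "f' \<in> I" "g \<in> J" "g' \<in> J"
    by auto
  then show "p + q \<in> {f + g |f g. f \<in> I \<and> g \<in> J}"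
    using poly_ideal_add[OF assms(1), of f f'] poly_ideal_add[OF assms(2), of g g']
    by (intro CollectI exI[of _ "f + f'"] exI[of _ "g + g'"]) (simp add: add_ac)
next
  fix h p assume "p \<in> {f + g |f g. f \<in> I \<and> g \<in> J}"
  then obtain f g where "p = f + g" "f \<in> I" "g \<in> J" by auto
  then show "h * p \<in> {f + g |f g. f \<in> I \<and> g \<in> J}"
    using poly_ideal_mult[OF assms(1), of f h] poly_ideal_mult[OF assms(2), of g h]
    by (intro CollectI exI[of _ "h * f"] exI[of _ "h * g"]) (simp add: distrib_left)
qed

lemma subset_ideal_sum:
  assumes "poly_ideal I" "poly_ideal J"
  shows "I \<subseteq> {f + g |f g. f \<in> I \<and> g \<in> J}" "J \<subseteq> {f + g |f g. f \<in> I \<and> g \<in> J}"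
proof -
  have "f = f + 0" "f = 0 + f" for f :: "'a cpoly" by simp_all
  then show "I \<subseteq> {f + g |f g. f \<in> I \<and> g \<in> J}" "J \<subseteq> {f + g |f g. f \<in> I \<and> g \<in> J}"
    using assms[THEN poly_ideal_0] by blast+
qed

lemma poly_ideal_principal: "poly_ideal (range (\<lambda>h. h * p))"
  by (auto simp: poly_ideal_iff mult.assoc[symmetric] distrib_right[symmetric]
      intro: image_eqI[of _ _ 0])

lemma poly_ideal_colon: "poly_ideal I \<Longrightarrow> poly_ideal {g. p * g \<in> I}"
  by (auto simp: poly_ideal_iff distrib_left mult.left_commute)

lemma poly_ideal_keys_subset:
  fixes U :: "'n::finite expo set"
  assumes "\<And>\<alpha> \<gamma>. \<alpha> \<in> U \<Longrightarrow> \<gamma> + \<alpha> \<in> U"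
  shows "poly_ideal {f :: 'n cpoly. Poly_Mapping.keys f \<subseteq> U}"
  unfolding poly_ideal_iff
proof (intro conjI ballI allI)
  fix h f :: "'n cpoly" assume "f \<in> {f. Poly_Mapping.keys f \<subseteq> U}"
  then show "h * f \<in> {f. Poly_Mapping.keys f \<subseteq> U}"
    using assms keys_mult[of h f] by blast
qed (use keys_add in fastforce)+

lemma monomial_mult_mem:
  assumes "poly_ideal K" "monomial \<alpha> \<in> K"
  shows "monomial (\<gamma> + \<alpha>) \<in> K"
  using poly_ideal_mult[OF assms, of "monomial \<gamma>"] by (simp add: mult_single)

lemma lookup_single_mult:
  fixes f :: "'n::finite cpoly"
  shows "Poly_Mapping.lookup (Poly_Mapping.single \<gamma> c * f) (\<gamma> + \<beta>) = c * Poly_Mapping.lookup f \<beta>"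
  by (simp add: lookup_mult lookup_single when_mult)

text \<open>The socle step: here \<open>s\<close> plays the role of \<open>x\<^sup>\<alpha>\<close> in the outline above.\<close>

lemma power_mem_maximal_avoiding:
  assumes K: "poly_ideal K" "s \<notin> K"
    and max: "\<And>L. poly_ideal L \<Longrightarrow> K \<subset> L \<Longrightarrow> s \<in> L"
    and socle: "p * s \<in> K"
    and stable: "\<And>g. p ^ (2 * Suc k) * g \<in> K \<Longrightarrow> p ^ Suc k * g \<in> K"
  shows "p ^ Suc k \<in> K"
proof (rule ccontr)
  let ?r = "p ^ Suc k"
  let ?L = "{f + g |f g. f \<in> K \<and> g \<in> range (\<lambda>h. h * ?r)}"
  assume r: "?r \<notin> K"
  have L: "poly_ideal ?L" "K \<subseteq> ?L" "range (\<lambda>h. h * ?r) \<subseteq> ?L"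
    using poly_ideal_sum[OF K(1) poly_ideal_principal] subset_ideal_sum[OF K(1) poly_ideal_principal]
    by blast+
  have "?r \<in> range (\<lambda>h. h * ?r)" by (rule range_eqI[of _ _ 1]) simp
  with r L(2,3) have "K \<noteq> ?L" by (metis subsetD)
  with L(2) have "K \<subset> ?L" by (rule psubsetI)
  from max[OF L(1) this] have "\<exists>f h. f \<in> K \<and> s = f + h * ?r" by auto
  then obtain f h where fh: "f \<in> K" "s = f + h * ?r" by (elim exE conjE)
  \<comment> \<open>The exponent \<open>Suc k\<close> is positive, so one factor \<open>p\<close>
    can be spent on \<open>socle\<close>; hence \<open>?r * s\<close> vanishes modulo
    \<open>K\<close>.\<close>
  have "p ^ k * (p * s) \<in> K" using K(1) socle by (rule poly_ideal_mult)
  moreover have "p ^ k * (p * s) = ?r * s"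
    by (simp only: power_Suc mult.assoc mult.left_commute)
  ultimately have "?r * s - ?r * f \<in> K"
    using poly_ideal_diff[OF K(1) _ poly_ideal_mult[OF K(1) fh(1)]] by simp
  \<comment> \<open>Thus \<open>p ^ (2 * Suc k) * h\<close> lies in \<open>K\<close>;
    \<open>stable\<close> strips one factor \<open>?r\<close>, after which both summands of
    \<open>s\<close> lie in \<open>K\<close>.\<close>
  moreover have "?r * s - ?r * f = p ^ (2 * Suc k) * h"
    unfolding fh(2) mult_2 power_add by (simp only: distrib_left add_diff_cancel_left' mult.assoc mult.commute[of h])
  ultimately have "?r * h \<in> K"
    using stable by metis
  then have "f + h * ?r \<in> K"
    using poly_ideal_add[OF K(1) fh(1)] by (simp only: mult.commute)
  with fh(2) K(2) show False by blast
qed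

section \<open>Local orders\<close>

lemma max_wrt_eqI:
  assumes "antisym {(a, b). R a b}" "m \<in> A" "\<And>a. a \<in> A \<Longrightarrow> R m a"
  shows "max_wrt R A = m"
  unfolding max_wrt_def using assms by (auto intro!: the_equality dest: antisymD)

lemma ex_max_of_linear_order:
  assumes R: "linear_order {(a, b). R a b}" and "finite A" "A \<noteq> {}"
  shows "\<exists>m\<in>A. \<forall>a\<in>A. R m a"
  using assms(2,3)
proof (induction A rule: finite_ne_induct)
  case (singleton x)
  from R show ?case by (auto simp: order_on_defs refl_on_def)
next
  case (insert x A)
  then obtain m where m: "m \<in> A" "\<And>a. a \<in> A \<Longrightarrow> R m a" by blast
  have "R x x" "R x m \<or> R m x" "\<And>a b c. R a b \<Longrightarrow> R b c \<Longrightarrow> R a c"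
    using R by (fastforce simp: order_on_defs refl_on_def total_on_def trans_def)+
  with m show ?case by blast
qed

lemma max_wrt_properties:
  assumes "linear_order {(a, b). R a b}" and "finite A" "A \<noteq> {}"
  shows "max_wrt R A \<in> A" and "a \<in> A \<Longrightarrow> R (max_wrt R A) a"
proof -
  obtain m where m: "m \<in> A" "\<And>a. a \<in> A \<Longrightarrow> R m a"
    using ex_max_of_linear_order[OF assms] by blast
  have "max_wrt R A = m"
    using assms(1) m by (intro max_wrt_eqI) (auto simp: order_on_defs)
  with m show "max_wrt R A \<in> A" "a \<in> A \<Longrightarrow> R (max_wrt R A) a" by auto
qed

lemma linear_order_dual_order:
  assumes "linear_order {(a, b). ge a b}"
  shows "linear_order {(a, b). dual_order ge a b}"
proof -
  have "{(a, b). dual_order ge a b} = {(a, b). ge a b}\<inverse>"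
    by (auto simp: dual_order_def)
  with assms show ?thesis by (simp only: linear_order_on_converse)
qed

locale local_order =
  fixes ge :: "'n::finite expo \<Rightarrow> 'n expo \<Rightarrow> bool"
  assumes local_monomial_order: "local_monomial_order ge"
begin

lemma linear: "linear_order {(\<alpha>, \<beta>). ge \<alpha> \<beta>}"
  and ge_add: "ge \<alpha> \<beta> \<Longrightarrow> ge (\<alpha> + \<gamma>) (\<beta> + \<gamma>)"
  and ge_0: "ge 0 \<alpha>"
  using local_monomial_order by (auto simp: local_monomial_order_def)

lemma ge_refl: "ge \<alpha> \<alpha>"
  and ge_trans: "ge \<alpha> \<beta> \<Longrightarrow> ge \<beta> \<gamma> \<Longrightarrow> ge \<alpha> \<gamma>"
  and ge_antisym: "ge \<alpha> \<beta> \<Longrightarrow> ge \<beta> \<alpha> \<Longrightarrow> \<alpha> = \<beta>"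
  and ge_total: "ge \<alpha> \<beta> \<or> ge \<beta> \<alpha>"
  using linear
  by (fastforce simp: order_on_defs refl_on_def total_on_def trans_def antisym_def)+

lemma ge_add_left: "ge \<alpha> (\<gamma> + \<alpha>)"
  using ge_add[OF ge_0, of \<alpha> \<gamma>] by simp

lemmas linear_dual = linear_order_dual_order[OF linear]

lemma antisym_dual: "antisym {(\<alpha>, \<beta>). dual_order ge \<alpha> \<beta>}"
  using linear_dual by (simp add: order_on_defs)

text \<open>Since \<open>1\<close> is the largest monomial, a multiple never exceeds the original. A
  chain rising strictly in \<open>ge\<close> would by Dickson's lemma contain a later multiple of an
  earlier member.\<close>

lemma wf_dual: "wf {(\<alpha>, \<beta>). ge \<alpha> \<beta> \<and> \<alpha> \<noteq> \<beta>}"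
  unfolding wf_iff_no_infinite_down_chain
proof (rule notI, elim exE)
  fix a assume a: "\<forall>i. (a (Suc i), a i) \<in> {(\<alpha>, \<beta>). ge \<alpha> \<beta> \<and> \<alpha> \<noteq> \<beta>}"
  have decr: "ge (a j) (a i) \<and> a j \<noteq> a i" if "i < j" for i j
    using that
  proof (induction rule: strict_inc_induct)
    case (base i)
    with a show ?case by auto
  next
    case (step i)
    with a have "ge (a (Suc i)) (a i)" "a (Suc i) \<noteq> a i" by auto
    with step.IH show ?case by (metis ge_trans ge_antisym)
  qed
  obtain i j \<gamma> where "i < j" "a j = \<gamma> + a i"
    using dickson[of a] by (auto simp: add.commute)
  with decr[of i j] ge_add_left[of "a i" \<gamma>] show False
    by (metis ge_antisym)
qed

text \<open>
  Hilbert's basis theorem. The leading terms used here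
  are those for the dual order, which by \<open>wf_dual\<close> is a monomial order in the global sense.
\<close>

lemma wf_ideals: "wf {(J', J :: 'n cpoly set). poly_ideal J \<and> poly_ideal J' \<and> J \<subset> J'}"
  unfolding wf_iff_no_infinite_down_chain
proof (rule notI, elim exE)
  fix J :: "nat \<Rightarrow> 'n cpoly set"
  assume "\<forall>i. (J (Suc i), J i) \<in> {(J', J). poly_ideal J \<and> poly_ideal J' \<and> J \<subset> J'}"
  then have ideal: "poly_ideal (J i)" and strict: "J i \<subset> J (Suc i)" for i by auto
  let ?lead = "in_poly (dual_order ge)"
  let ?less = "{(\<alpha>, \<beta>). ge \<alpha> \<beta> \<and> \<alpha> \<noteq> \<beta>}"
  \<comment> \<open>Each gap of the chain gets an element with minimal leading exponent; the
    contradiction will be an element of the same gap with a smaller one.\<close>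
  have "\<exists>f\<in>J (Suc i) - J i. \<forall>g. (g, f) \<in> inv_image ?less ?lead \<longrightarrow> g \<notin> J (Suc i) - J i" for i
  proof -
    obtain g where "g \<in> J (Suc i) - J i"
      using psubset_imp_ex_mem[OF strict, of i] by (elim exE)
    with wf_inv_image[OF wf_dual, of ?lead] show ?thesis
      by (rule wfE_min) (intro bexI allI impI)
  qed
  then have "\<forall>i. \<exists>f. f \<in> J (Suc i) - J i \<and>
      (\<forall>g. (g, f) \<in> inv_image ?less ?lead \<longrightarrow> g \<notin> J (Suc i) - J i)"
    by (simp only: Bex_def simp_thms)
  from choice[OF this]
  obtain f where "\<forall>i. f i \<in> J (Suc i) - J i \<and>
      (\<forall>g. (g, f i) \<in> inv_image ?less ?lead \<longrightarrow> g \<notin> J (Suc i) - J i)"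
    by (elim exE)
  then have f: "\<And>i. f i \<in> J (Suc i)" "\<And>i. f i \<notin> J i"
    and least: "\<And>i g. (g, f i) \<in> inv_image ?less ?lead \<Longrightarrow> g \<notin> J (Suc i) - J i"
    by simp_all
  have nz: "f i \<noteq> 0" for i
    using f(2) poly_ideal_0[OF ideal] by metis
  obtain i j \<gamma> where ij: "i < j" and \<gamma>: "?lead (f j) = \<gamma> + ?lead (f i)"
    using dickson[of "\<lambda>i. ?lead (f i)"] by (auto simp: add.commute)
  have lead_in: "?lead g \<in> Poly_Mapping.keys g" if "g \<noteq> 0" for g
    using that max_wrt_properties(1)[OF linear_dual, of "Poly_Mapping.keys g"]
    by (simp add: in_poly_def)
  have lead_ge: "ge \<beta> (?lead g)" if "\<beta> \<in> Poly_Mapping.keys g" for \<beta> g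
    using that max_wrt_properties(2)[OF linear_dual, of "Poly_Mapping.keys g" \<beta>]
    by (cases "g = 0") (simp_all add: in_poly_def dual_order_def[of ge _ \<beta>])
  \<comment> \<open>Subtracting \<open>p\<close> cancels the leading term of \<open>f j\<close>. As
    \<open>i < j\<close>, \<open>p\<close> lies in \<open>J j\<close>, so \<open>g\<close> stays in
    the gap of \<open>f j\<close>.\<close>
  define c where "c = Poly_Mapping.lookup (f j) (?lead (f j)) / Poly_Mapping.lookup (f i) (?lead (f i))"
  define p where "p = Poly_Mapping.single \<gamma> c * f i"
  define g where "g = f j - p"
  have "J (Suc i) \<subseteq> J j"
    by (rule monoD[OF incseq_SucI[of J, OF psubset_imp_subset[OF strict]] Suc_leI[OF ij]])
  then have p: "p \<in> J j"
    unfolding p_def using f(1) poly_ideal_mult[OF ideal] by blast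
  have "g \<notin> J j"
  proof
    assume "g \<in> J j"
    then have "g + p \<in> J j" using p poly_ideal_add[OF ideal] by blast
    then show False using f(2) by (simp add: g_def)
  qed
  moreover have "g \<in> J (Suc j)"
    unfolding g_def using p f(1) strict[of j] by (intro poly_ideal_diff ideal) auto
  moreover have "(g, f j) \<in> inv_image ?less ?lead"
  proof -
    have "g \<noteq> 0" using calculation(1) poly_ideal_0[OF ideal] by metis
    have "Poly_Mapping.lookup g (?lead (f j)) = 0"
      using lead_in[OF nz, of i]
      by (simp add: g_def p_def lookup_minus \<gamma> lookup_single_mult)
        (simp add: c_def \<gamma> in_keys_iff)
    then have "?lead g \<noteq> ?lead (f j)"
      using lead_in[OF \<open>g \<noteq> 0\<close>] by (auto simp: in_keys_iff)
    moreover have "ge \<beta> (?lead (f j))" if "\<beta> \<in> Poly_Mapping.keys p" for \<beta>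
    proof -
      obtain \<beta>' where "\<beta> = \<gamma> + \<beta>'" "\<beta>' \<in> Poly_Mapping.keys (f i)"
        using \<open>\<beta> \<in> _\<close> keys_mult[of "Poly_Mapping.single \<gamma> c" "f i"]
        by (auto simp: p_def split: if_splits)
      then show ?thesis
        using ge_add[OF lead_ge, of \<beta>' "f i" \<gamma>] by (simp add: \<gamma> add.commute)
    qed
    then have "ge (?lead g) (?lead (f j))"
      using lead_in[OF \<open>g \<noteq> 0\<close>] lead_ge[of _ "f j"] keys_diff[of "f j" p] unfolding g_def by blast
    ultimately show ?thesis by simp
  qed
  ultimately show False using least by blast
qed

text \<open>The relation in \<open>wf_ideals\<close> places larger ideals lower, so its minimal
  elements are the inclusion-maximal ones; \<open>J\<close> witnesses that \<open>S\<close> is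
  nonempty.\<close>

lemma ex_maximal_ideal:
  fixes S :: "'n cpoly set set"
  assumes "J \<in> S" "\<And>J. J \<in> S \<Longrightarrow> poly_ideal J"
  shows "\<exists>K\<in>S. \<forall>L\<in>S. \<not> K \<subset> L"
proof -
  obtain K where K: "K \<in> S"
    and min: "\<And>L. (L, K) \<in> {(J', J). poly_ideal J \<and> poly_ideal J' \<and> J \<subset> J'} \<Longrightarrow> L \<notin> S"
    using wfE_min[OF wf_ideals assms(1)] by blast
  have "\<not> K \<subset> L" if "L \<in> S" for L
    using min[of L] that K assms(2) by blast
  with K show ?thesis by blast
qed

text \<open>Supplies the stability hypothesis of \<open>power_mem_maximal_avoiding\<close>: among
  the colon ideals of \<open>K\<close> by positive powers of \<open>p\<close> one is maximal, and it
  cannot grow when the exponent is doubled.\<close>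

lemma ex_power_mem_maximal_avoiding:
  fixes K :: "'n cpoly set"
  assumes K: "poly_ideal K" "s \<notin> K"
    and max: "\<And>L. poly_ideal L \<Longrightarrow> K \<subset> L \<Longrightarrow> s \<in> L"
    and socle: "p * s \<in> K"
  shows "\<exists>k. p ^ k \<in> K"
proof -
  let ?C = "\<lambda>k. {g. p ^ Suc k * g \<in> K}"
  have "\<exists>L\<in>range ?C. \<forall>L'\<in>range ?C. \<not> L \<subset> L'"
  proof (rule ex_maximal_ideal)
    show "poly_ideal L" if "L \<in> range ?C" for L
      using that poly_ideal_colon[OF K(1)] by (elim rangeE) (simp only:)
  qed (rule rangeI[of _ 0])
  then obtain k where k: "\<And>l. \<not> ?C k \<subset> ?C l" by (elim bexE rangeE) (simp only: ball_simps, metis)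
  have "p ^ Suc k * g \<in> K" if "p ^ (2 * Suc k) * g \<in> K" for g
  proof -
    have *: "p ^ Suc (Suc (2 * k)) * h = p ^ Suc k * (p ^ Suc k * h)" for h
    proof -
      have "Suc (Suc (2 * k)) = Suc k + Suc k" by simp
      then show ?thesis by (simp only: power_add mult.assoc)
    qed
    \<comment> \<open>\<open>?C\<close> is shifted by one to exclude the exponent zero, so the index
      \<open>Suc (2 * k)\<close> belongs to the exponent \<open>2 * Suc k\<close>.\<close>
    have "?C k \<subseteq> ?C (Suc (2 * k))"
      using poly_ideal_mult[OF K(1)] by (auto simp only: *)
    with k have "?C k = ?C (Suc (2 * k))" by blast
    with that show ?thesis by auto
  qed
  from power_mem_maximal_avoiding[OF assms this] show ?thesis by blast
qed

end

section \<open>Functionals vanishing on an ideal\<close>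

lemma functional_of_eq_sum:
  "functional_of c f = (\<Sum>\<alpha>\<in>Poly_Mapping.keys c. Poly_Mapping.lookup c \<alpha> * Poly_Mapping.lookup f \<alpha>)"
  by (simp add: functional_of_def mono_functional_eq_lookup)

text \<open>A basis of \<open>K\<close> together with \<open>s\<close> carries a linear functional
  that is one at \<open>s\<close> and zero on \<open>K\<close>. It kills all but finitely many
  monomials, so finitely many coefficients describe it.\<close>

lemma ex_functional_separating:
  fixes K :: "'n::finite cpoly set"
  assumes K: "poly_ideal K" "s \<notin> K" and cofinite: "finite {\<alpha>. monomial \<alpha> \<notin> K}"
  shows "\<exists>c. functional_of c s = 1 \<and> (\<forall>f\<in>K. functional_of c f = 0)"
proof -
  let ?scale = "\<lambda>c (f :: 'n cpoly). Poly_Mapping.single 0 c * f"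
  interpret vector_space_pair ?scale "(*) :: complex \<Rightarrow> complex \<Rightarrow> complex"
    by unfold_locales
      (simp_all add: distrib_left distrib_right single_add mult_single flip: mult.assoc)
  have sub: "vs1.subspace K"
    using K by (auto simp: vs1.subspace_def poly_ideal_iff)
  obtain B where B: "B \<subseteq> K" "vs1.independent B" "K \<subseteq> vs1.span B"
    using vs1.maximal_independent_subset by blast
  have "vs1.span B \<subseteq> K"
    using B(1) sub by (rule vs1.span_minimal)
  with K(2) B(2) have "vs1.independent (insert s B)"
    by (intro vs1.independent_insertI) auto
  then obtain \<phi> where lin: "Vector_Spaces.linear ?scale (*) \<phi>"
    and \<phi>: "\<And>x. x \<in> insert s B \<Longrightarrow> \<phi> x = (if x = s then 1 else 0)"
    using linear_independent_extend[of "insert s B" "\<lambda>x. if x = s then 1 else 0"] by metis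
  interpret \<phi>: Vector_Spaces.linear ?scale "(*)" \<phi> by (rule lin)
  have \<phi>K: "\<phi> f = 0" if "f \<in> K" for f
  proof (rule linear_eq_0_on_span[OF lin])
    show "f \<in> vs1.span B" using that B(3) by blast
    show "\<phi> x = 0" if "x \<in> B" for x
      using \<phi>[of x] that B(1) K(2) by auto
  qed
  define c where "c = Abs_poly_mapping (\<lambda>\<alpha>. \<phi> (monomial \<alpha>))"
  \<comment> \<open>\<open>Abs_poly_mapping\<close> returns the intended coefficients only for
    finite support, which comes from \<open>cofinite\<close>.\<close>
  have "finite {\<alpha>. \<phi> (monomial \<alpha>) \<noteq> 0}"
    by (rule finite_subset[OF _ cofinite]) (auto simp: \<phi>K)
  then have lookup_c: "Poly_Mapping.lookup c \<alpha> = \<phi> (monomial \<alpha>)" for \<alpha>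
    by (simp add: c_def)
  have "functional_of c f = \<phi> f" for f
  proof -
    have "f = (\<Sum>\<alpha>\<in>Poly_Mapping.keys f. ?scale (Poly_Mapping.lookup f \<alpha>) (monomial \<alpha>))"
      by (intro poly_mapping_eqI)
        (simp add: mult_single lookup_sum lookup_single when_def in_keys_iff)
    then have "\<phi> f = (\<Sum>\<alpha>\<in>Poly_Mapping.keys f. Poly_Mapping.lookup f \<alpha> * Poly_Mapping.lookup c \<alpha>)"
      by (metis (no_types, lifting) \<phi>.sum \<phi>.scale lookup_c sum.cong)
    also have "\<dots> = (\<Sum>\<alpha>\<in>Poly_Mapping.keys f \<union> Poly_Mapping.keys c.
        Poly_Mapping.lookup f \<alpha> * Poly_Mapping.lookup c \<alpha>)"
      by (intro sum.mono_neutral_left) (auto simp: in_keys_iff)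
    also have "\<dots> = functional_of c f"
      unfolding functional_of_eq_sum
      by (intro sum.mono_neutral_cong_right) (auto simp: in_keys_iff mult.commute)
    finally show ?thesis ..
  qed
  then show ?thesis using \<phi>K \<phi>[of s] by (intro exI[of _ c]) simp
qed

text \<open>A power of each variable in \<open>K\<close> bounds the exponents of every monomial
  outside \<open>K\<close>, which leaves a finite box.\<close>

lemma finite_monomials_not_mem:
  fixes K :: "'n::finite cpoly set"
  assumes K: "poly_ideal K" and "\<And>i. \<exists>k. monomial (Poly_Mapping.single i 1) ^ k \<in> K"
  shows "finite {\<alpha>. monomial \<alpha> \<notin> K}"
proof -
  have pow: "monomial (Poly_Mapping.single i 1) ^ k = monomial (Poly_Mapping.single i k)" for i :: 'n and k
    by (induction k) (auto simp: mult_single single_add[symmetric])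
  obtain k where k: "\<And>i. monomial (Poly_Mapping.single i (k i)) \<in> K"
    using assms(2) unfolding pow by metis
  let ?F = "{\<alpha>. \<forall>i. Poly_Mapping.lookup \<alpha> i < k i} :: 'n expo set"
  have "Poly_Mapping.lookup \<alpha> i < k i" if "monomial \<alpha> \<notin> K" for \<alpha> i
  proof (rule ccontr)
    assume "\<not> ?thesis"
    then have "\<alpha> = (\<alpha> - Poly_Mapping.single i (k i)) + Poly_Mapping.single i (k i)"
      by (intro poly_mapping_eqI) (auto simp: lookup_add lookup_minus lookup_single when_def)
    with monomial_mult_mem[OF K k] that show False by metis
  qed
  then have "{\<alpha>. monomial \<alpha> \<notin> K} \<subseteq> ?F" by auto
  moreover have "finite ?F"
  proof (rule finite_imageD)
    have "finite {f :: 'n \<Rightarrow> nat. \<forall>i. (i \<in> UNIV \<longrightarrow> f i \<in> {..Max (range k)}) \<and> (i \<notin> UNIV \<longrightarrow> f i = 0)}"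
      by (intro finite_set_of_finite_funs) auto
    then show "finite (Poly_Mapping.lookup ` ?F)"
      by (rule rev_finite_subset) (auto intro: less_imp_le[OF less_le_trans] Max_ge)
    show "inj_on Poly_Mapping.lookup ?F"
      by (intro inj_onI poly_mapping_eqI) simp
  qed
  ultimately show ?thesis by (rule finite_subset)
qed

section \<open>Disjointness and covering for the two sets of initial exponents\<close>

context local_order
begin

lemma in_functionals_disjoint_in_ideal:
  "in_functionals (dual_order ge) (D0_ideal I) \<inter> in_ideal ge I = {}"
proof (rule ccontr)
  assume "\<not> ?thesis"
  then obtain q f where q: "q \<in> D0_ideal I" "q \<noteq> (\<lambda>_. 0)" and f: "f \<in> I" "f \<noteq> 0"
    and eq: "in_functional (dual_order ge) q = in_poly ge f"
    by (auto simp: in_functionals_def in_ideal_def)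
  obtain c where c: "q = functional_of c" using q(1) by (auto simp: D0_ideal_def D0_def)
  let ?\<alpha> = "in_poly ge f"
  have "c \<noteq> 0" using q(2) by (auto simp: c functional_of_eq_sum)
  then have c\<alpha>: "?\<alpha> \<in> Poly_Mapping.keys c" "\<And>\<beta>. \<beta> \<in> Poly_Mapping.keys c \<Longrightarrow> ge \<beta> ?\<alpha>"
    using max_wrt_properties[OF linear_dual, of "Poly_Mapping.keys c"]
    by (simp_all add: eq[symmetric] in_functional_def c) (simp add: dual_order_def)
  have f\<alpha>: "?\<alpha> \<in> Poly_Mapping.keys f" "\<And>\<beta>. \<beta> \<in> Poly_Mapping.keys f \<Longrightarrow> ge ?\<alpha> \<beta>"
    using f(2) max_wrt_properties[OF linear, of "Poly_Mapping.keys f"]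
    by (auto simp: in_poly_def)
  \<comment> \<open>In the order \<open>ge\<close> all exponents of \<open>c\<close> are at least
    \<open>?\<alpha>\<close> and all those of \<open>f\<close> at most \<open>?\<alpha>\<close>, so
    antisymmetry leaves one common exponent.\<close>
  have "q f = (\<Sum>\<beta>\<in>{?\<alpha>}. Poly_Mapping.lookup c \<beta> * Poly_Mapping.lookup f \<beta>)"
    unfolding c functional_of_eq_sum
  proof (intro sum.mono_neutral_right ballI)
    fix \<beta> assume "\<beta> \<in> Poly_Mapping.keys c - {?\<alpha>}"
    then have "\<beta> \<notin> Poly_Mapping.keys f"
      using c\<alpha>(2) f\<alpha>(2) ge_antisym by blast
    then show "Poly_Mapping.lookup c \<beta> * Poly_Mapping.lookup f \<beta> = 0"
      by (simp add: in_keys_iff)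
  qed (use c\<alpha> in auto)
  also have "\<dots> \<noteq> 0" using c\<alpha>(1) f\<alpha>(1) by (simp add: in_keys_iff)
  finally show False using q(1) f(1) by (simp add: D0_ideal_def)
qed

lemma mem_in_functionals:
  assumes I: "poly_ideal I" and \<alpha>: "\<alpha> \<notin> in_ideal ge I"
  shows "\<alpha> \<in> in_functionals (dual_order ge) (D0_ideal I)"
proof -
  define U where "U = {\<beta>. ge \<alpha> \<beta> \<and> \<beta> \<noteq> \<alpha>}"
  define M :: "'n cpoly set" where "M = {f. Poly_Mapping.keys f \<subseteq> U}"
  define J where "J = {f + g |f g. f \<in> I \<and> g \<in> M}"
  have U_up: "\<gamma> + \<beta> \<in> U" if "\<beta> \<in> U" for \<beta> \<gamma>
    using that ge_add_left[of \<beta> \<gamma>] unfolding U_def mem_Collect_eq by (metis ge_trans ge_antisym)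
  have M: "poly_ideal M"
    unfolding M_def using U_up by (rule poly_ideal_keys_subset)
  have J: "poly_ideal J"
    unfolding J_def using I M by (rule poly_ideal_sum)
  have "I \<subseteq> J" "M \<subseteq> J"
    unfolding J_def using subset_ideal_sum[OF I M] .
  \<comment> \<open>Otherwise \<open>monomial \<alpha> - g\<close> would be an element of
    \<open>I\<close> with initial exponent \<open>\<alpha>\<close>, because \<open>g\<close> has
    only strictly smaller exponents.\<close>
  have "monomial \<alpha> \<notin> J"
  proof
    assume "monomial \<alpha> \<in> J"
    then obtain f g where "f \<in> I" "g \<in> M" "monomial \<alpha> = f + g"
      unfolding J_def by blast
    then have fg: "f \<in> I" "g \<in> M" "f = monomial \<alpha> - g" by simp_all
    have "\<alpha> \<notin> Poly_Mapping.keys g" using fg(2) by (auto simp: M_def U_def)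
    then have "\<alpha> \<in> Poly_Mapping.keys f"
      by (simp add: fg(3) in_keys_iff lookup_minus)
    moreover have "ge \<alpha> \<beta>" if "\<beta> \<in> Poly_Mapping.keys f" for \<beta>
      using that fg(2) keys_diff[of "monomial \<alpha>" g] ge_refl
      by (auto simp: fg(3) M_def U_def)
    ultimately have "in_poly ge f = \<alpha>"
      unfolding in_poly_def using linear by (intro max_wrt_eqI) (auto simp: order_on_defs)
    with \<open>\<alpha> \<in> Poly_Mapping.keys f\<close> fg(1) \<alpha> show False by (auto simp: in_ideal_def)
  qed
  with J have "J \<in> {K. poly_ideal K \<and> J \<subseteq> K \<and> monomial \<alpha> \<notin> K}" by blast
  from ex_maximal_ideal[OF this, simplified] obtain K
    where K: "poly_ideal K" "J \<subseteq> K" "monomial \<alpha> \<notin> K"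
      and max: "\<And>L. poly_ideal L \<Longrightarrow> J \<subseteq> L \<Longrightarrow> monomial \<alpha> \<notin> L \<Longrightarrow> \<not> K \<subset> L"
    by auto
  have "\<exists>k. monomial (Poly_Mapping.single i 1) ^ k \<in> K" for i
  proof (rule ex_power_mem_maximal_avoiding[OF K(1,3)])
    show "monomial \<alpha> \<in> L" if "poly_ideal L" "K \<subset> L" for L
      using max[of L] that K(2) by blast
    \<comment> \<open>Multiplication by a variable strictly lowers a monomial in a local order, so
      the socle condition already holds in \<open>M\<close>.\<close>
    have "Poly_Mapping.single i 1 + \<alpha> \<in> U"
      using ge_add_left by (auto simp: U_def dest: arg_cong[of _ _ Poly_Mapping.keys])
    then have "monomial (Poly_Mapping.single i 1 + \<alpha>) \<in> M"
      by (simp add: M_def)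
    then show "monomial (Poly_Mapping.single i 1) * monomial \<alpha> \<in> K"
      using \<open>M \<subseteq> J\<close> K(2) by (auto simp: mult_single)
  qed
  from ex_functional_separating[OF K(1,3) finite_monomials_not_mem[OF K(1) this]]
  obtain c where c: "functional_of c (monomial \<alpha>) = 1" "\<And>f. f \<in> K \<Longrightarrow> functional_of c f = 0"
    by blast
  \<comment> \<open>By totality any other \<open>\<beta>\<close> lies in \<open>U\<close>, so its
    monomial is in \<open>K\<close> and its coefficient, the value of the functional there,
    vanishes. Hence \<open>\<alpha>\<close> is the maximum for the dual order.\<close>
  have "ge \<beta> \<alpha>" if "\<beta> \<in> Poly_Mapping.keys c" for \<beta>
  proof (rule ccontr)
    assume "\<not> ge \<beta> \<alpha>"
    then have "\<beta> \<in> U" using ge_total ge_refl by (auto simp: U_def)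
    then have "monomial \<beta> \<in> M" by (simp add: M_def)
    then have "monomial \<beta> \<in> K" using \<open>M \<subseteq> J\<close> K(2) by blast
    from c(2)[OF this] that show False by (simp add: functional_of_single in_keys_iff)
  qed
  moreover have "\<alpha> \<in> Poly_Mapping.keys c"
    using c(1) by (simp add: functional_of_single in_keys_iff)
  ultimately have "in_functional (dual_order ge) (functional_of c) = \<alpha>"
    unfolding in_functional_def functional_coeffs_functional_of
    by (intro max_wrt_eqI antisym_dual) (simp_all add: dual_order_def)
  moreover have "functional_of c \<in> D0_ideal I"
    using c(2) \<open>I \<subseteq> J\<close> K(2) by (auto simp: D0_ideal_def D0_def)
  moreover have "functional_of c \<noteq> (\<lambda>_. 0)"
    using c(1) by (metis zero_neq_one)
  ultimately show ?thesis by (auto simp: in_functionals_def)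
qed

end

theorem theorem3p3:
  fixes ge :: "'n::finite expo \<Rightarrow> 'n expo \<Rightarrow> bool"
    and I :: "'n cpoly set"
  assumes "local_monomial_order ge"
    and "poly_ideal I"
  shows "in_functionals (dual_order ge) (D0_ideal I) \<union> in_ideal ge I = UNIV
    \<and> in_functionals (dual_order ge) (D0_ideal I) \<inter> in_ideal ge I = {}"
proof -
  interpret local_order ge using assms(1) by unfold_locales
  show ?thesis
    using mem_in_functionals[OF assms(2)] in_functionals_disjoint_in_ideal by blast
qed

end
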